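(* For every integer $n\geq 1$, $\mathrm{ex}_{\mathcal{P}}(n,S_{2,5})\leq \frac{20}{7}n$.
   Context: All graphs are finite and simple. For a graph $F$, the planar Turán number $\mathrm{ex}_{\mathcal{P}}(n,F)$ is the maximum number of edges in an $n$-vertex planar graph that contains no subgraph isomorphic to $F$. For positive integers $m,k$, the double star $S_{m,k}$ is the tree obtained from an edge $xy$ (the backbone) by joining $x$ to $m$ new vertices and $y$ to $k$ further new vertices, all these $m+k$ vertices distinct. *)

theory Defs
  imports "HOL-Analysis.Analysis"
begin

definition simple_graph :: "'a set \<Rightarrow> 'a set set \<Rightarrow> bool" where
  "simple_graph V E \<longleftrightarrow> finite V \<and>
     (\<forall>e\<in>E. \<exists>u v. u \<noteq> v \<and> u \<in> V \<and> v \<in> V \<and> e = {u, v})"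

definition planar :: "'a set \<Rightarrow> 'a set set \<Rightarrow> bool" where
  "planar V E \<longleftrightarrow>
     (\<exists>(p :: 'a \<Rightarrow> complex) (\<gamma> :: 'a set \<Rightarrow> real \<Rightarrow> complex).
        inj_on p V \<and>
        (\<forall>u v. {u, v} \<in> E \<longrightarrow>
            arc (\<gamma> {u, v}) \<and>
            {pathstart (\<gamma> {u, v}), pathfinish (\<gamma> {u, v})} = {p u, p v} \<and>
            path_image (\<gamma> {u, v}) \<inter> p ` V = {p u, p v}) \<and>
        (\<forall>e\<in>E. \<forall>f\<in>E. e \<noteq> f \<longrightarrow>
            path_image (\<gamma> e) \<inter> path_image (\<gamma> f) \<subseteq> p ` (e \<inter> f)))"

definition contains_copy :: "'a set \<Rightarrow> 'a set set \<Rightarrow> 'b set \<Rightarrow> 'b set set \<Rightarrow> bool" where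
  "contains_copy V E VF EF \<longleftrightarrow>
     (\<exists>f. inj_on f VF \<and> f ` VF \<subseteq> V \<and> (\<forall>e\<in>EF. f ` e \<in> E))"

definition double_star_V :: "nat \<Rightarrow> nat \<Rightarrow> nat set" where
  "double_star_V m k = {0..m+k+1}"

definition double_star_E :: "nat \<Rightarrow> nat \<Rightarrow> nat set set" where
  "double_star_E m k = {{0,1}} \<union> {{0,i} | i. i \<in> {2..m+1}} \<union> {{1,i} | i. i \<in> {m+2..m+k+1}}"

definition ex_P :: "nat \<Rightarrow> 'b set \<Rightarrow> 'b set set \<Rightarrow> nat" where
  "ex_P n VF EF = Max {card E | E. simple_graph {..<n} E \<and> planar {..<n} E \<and>
                          \<not> contains_copy {..<n} E VF EF}"

end

theory Submission
  imports Defs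
begin

text \<open>
  Planarity enters only through the fact that \<open>K\<^sub>3\<^sub>,\<^sub>3\<close> is not planar. If \<open>G\<close> has no
  \<open>K\<^sub>3\<^sub>,\<^sub>3\<close>, then a set of \<open>k\<close> neighbours of a vertex induces a graph without \<open>K\<^sub>2\<^sub>,\<^sub>3\<close>, so its
  degrees \<open>h\<close> satisfy \<open>\<Sum> h (h - 1) \<le> 2 k (k - 1)\<close>. Vertices of degree at most 2 can be deleted,
  so let the minimum degree be at least 3. As \<open>G\<close> has no \<open>S\<^sub>2\<^sub>,\<^sub>5\<close>, there is then no vertex of degree 8
  or more, the closed neighbourhood of a vertex of degree 7 is a union of components and has few
  edges, and a neighbour of a vertex \<open>y\<close> of degree 6 has at most one neighbour outside the closed
  neighbourhood of \<open>y\<close>. By the inequality the neighbours of such a \<open>y\<close> cannot almost all have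
  degree 6, so in a graph of maximum degree 6 discharging from degrees at most 5 to degree 6 gives
  average degree at most 40/7.
\<close>

section \<open>Theta curves and connected sets avoiding them\<close>

lemma connected_subset_inside:
  assumes "connected X" "X \<inter> S = {}" "X \<inter> inside S \<noteq> {}"
  shows "X \<subseteq> inside S"
proof
  fix y assume "y \<in> X"
  obtain x where "x \<in> X" "x \<in> inside S" using assms by blast
  then have "connected_component (- S) x y"
    using assms \<open>y \<in> X\<close> by (meson connected_component_def disjoint_eq_subset_Compl)
  with \<open>x \<in> inside S\<close> show "y \<in> inside S" by (meson inside_same_component)
qed

text \<open>Apply the Jordan curve theorem to \<open>c\<close> followed by the reversal of
  \<open>d\<close>. The closure formula holds because the whole curve is the frontier of its
  inside.\<close>

lemma Jordan_two_arcs: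
  fixes c d :: "real \<Rightarrow> complex"
  assumes "arc c" "pathstart c = a" "pathfinish c = b"
    and "arc d" "pathstart d = a" "pathfinish d = b"
    and "path_image c \<inter> path_image d = {a,b}"
  defines "S \<equiv> path_image c \<union> path_image d"
  shows "inside S \<noteq> {}" "connected (inside S)" "connected (outside S)"
    "closure (inside S) = inside S \<union> S"
proof -
  have sp: "simple_path (c +++ reversepath d)" and loop: "pathfinish (c +++ reversepath d) = pathstart (c +++ reversepath d)"
    using assms by (auto simp: simple_path_join_loop_eq arc_simple_path simple_path_reversepath)
  have S: "path_image (c +++ reversepath d) = S"
    using assms by (simp add: path_image_join)
  note J = Jordan_inside_outside[OF sp loop, unfolded S]
  show "inside S \<noteq> {}" "connected (inside S)" "connected (outside S)"
    using J by auto
  show "closure (inside S) = inside S \<union> S"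
    using J by (simp add: closure_Un_frontier)
qed

locale theta =
  fixes a b :: complex and c1 c2 c3 :: "real \<Rightarrow> complex"
  assumes arcs: "arc c1" "arc c2" "arc c3"
    and starts: "pathstart c1 = a" "pathstart c2 = a" "pathstart c3 = a"
    and finishes: "pathfinish c1 = b" "pathfinish c2 = b" "pathfinish c3 = b"
    and disjnt: "path_image c1 \<inter> path_image c2 = {a,b}" "path_image c1 \<inter> path_image c3 = {a,b}"
      "path_image c2 \<inter> path_image c3 = {a,b}"
begin

lemma rotate: "theta a b c2 c3 c1"
  using arcs starts finishes disjnt by (unfold_locales) auto

lemma ends_neq: "a \<noteq> b"
  using arcs(1) starts(1) finishes(1) arc_distinct_ends by blast

text \<open>If \<open>X\<close> reached all three arcs, it would lie in one of the two halves of the inside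
  of \<open>c1 \<union> c2\<close> cut out by \<open>c3\<close>, but the closure of each half misses the interior of one arc.\<close>

lemma no_connected_set_inside:
  assumes X: "connected X" "X \<inter> (path_image c1 \<union> path_image c2 \<union> path_image c3) = {}"
    and q: "q1 \<in> path_image c1 - {a,b}" "q2 \<in> path_image c2 - {a,b}" "q3 \<in> path_image c3 - {a,b}"
    and cl: "q1 \<in> closure X" "q2 \<in> closure X" "q3 \<in> closure X"
    and ne: "path_image c3 \<inter> inside (path_image c1 \<union> path_image c2) \<noteq> {}"
  shows False
proof -
  let ?I = "inside (path_image c1 \<union> path_image c2)"
  let ?I1 = "inside (path_image c1 \<union> path_image c3)"
  let ?I2 = "inside (path_image c2 \<union> path_image c3)"
  have simple: "simple_path c1" "simple_path c2" "simple_path c3"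
    using arcs by (auto intro: arc_imp_simple_path)
  obtain disj: "?I1 \<inter> ?I2 = {}" and split: "?I1 \<union> ?I2 \<union> (path_image c3 - {a,b}) = ?I"
    using split_inside_simple_closed_curve[OF simple(1) starts(1) finishes(1) simple(2) starts(2)
        finishes(2) simple(3) starts(3) finishes(3) ends_neq disjnt ne] .
  have conn: "connected (insert q X)" if "q \<in> closure X" for q
    by (rule connected_intermediate_closure[OF X(1)]) (use that closure_subset in auto)
  \<comment> \<open>By \<open>split\<close>, \<open>q3\<close> lies in \<open>?I\<close>. Adding
    this limit point keeps \<open>X\<close> connected and still disjoint from \<open>c1\<close> and
    \<open>c2\<close>, so all of \<open>X\<close> is dragged into \<open>?I\<close>.\<close>
  have "insert q3 X \<subseteq> ?I"
    by (rule connected_subset_inside[OF conn[OF cl(3)]]) (use X q disjnt split in auto)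
  moreover have "X \<noteq> {}" using cl(1) by auto
  ultimately have "X \<inter> ?I1 \<noteq> {} \<or> X \<inter> ?I2 \<noteq> {}"
    using split X(2) by blast
  moreover have False if "X \<inter> ?I1 \<noteq> {}"
  proof -
    have "insert q2 X \<subseteq> ?I1"
      by (rule connected_subset_inside[OF conn[OF cl(2)]]) (use X q disjnt that in auto)
    then have "q2 \<in> ?I" using split by blast
    then show False using q(2) inside_no_overlap[of "path_image c1 \<union> path_image c2"] by blast
  qed
  moreover have False if "X \<inter> ?I2 \<noteq> {}"
  proof -
    have "insert q1 X \<subseteq> ?I2"
      by (rule connected_subset_inside[OF conn[OF cl(1)]]) (use X q disjnt that in auto)
    then have "q1 \<in> ?I" using split by blast
    then show False using q(1) inside_no_overlap[of "path_image c1 \<union> path_image c2"] by blast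
  qed
  ultimately show False by blast
qed

text \<open>Otherwise the connected inside of \<open>c1\<close> and \<open>c2\<close>, which misses
  \<open>c1\<close> and \<open>c3\<close>, lies inside the curve they form. Taking closures,
  \<open>c2\<close> lies in that inside or on that curve; the former is excluded, and the latter
  leaves only the points \<open>a\<close> and \<open>b\<close>.\<close>

lemma inside_subset_outside:
  assumes "path_image c3 \<inter> inside (path_image c1 \<union> path_image c2) = {}"
    and "path_image c2 \<inter> inside (path_image c1 \<union> path_image c3) = {}"
  shows "inside (path_image c1 \<union> path_image c2) \<subseteq> outside (path_image c1 \<union> path_image c3)"
proof (rule ccontr)
  let ?I = "inside (path_image c1 \<union> path_image c2)"
  let ?I1 = "inside (path_image c1 \<union> path_image c3)"
  note J = Jordan_two_arcs[OF arcs(1) starts(1) finishes(1) arcs(2) starts(2) finishes(2) disjnt(1)]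
  note J1 = Jordan_two_arcs[OF arcs(1) starts(1) finishes(1) arcs(3) starts(3) finishes(3) disjnt(2)]
  assume neg: "\<not> ?I \<subseteq> outside (path_image c1 \<union> path_image c3)"
  have "?I \<inter> path_image c1 = {}"
    using inside_no_overlap[of "path_image c1 \<union> path_image c2"] by blast
  with assms(1) have "?I \<inter> (path_image c1 \<union> path_image c3) = {}"
    by blast
  moreover from this neg have "?I \<inter> ?I1 \<noteq> {}"
    using inside_Un_outside[of "path_image c1 \<union> path_image c3"] by blast
  ultimately have "?I \<subseteq> ?I1"
    using J(2) connected_subset_inside by blast
  then have "closure ?I \<subseteq> closure ?I1" by (rule closure_mono)
  then have "path_image c2 \<subseteq> path_image c1 \<union> path_image c3"
    using J(4) J1(4) assms(2) by auto
  then have "path_image c2 \<subseteq> {a,b}" using disjnt by blast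
  moreover have "path_image c2 - {a,b} \<noteq> {}"
    using nonempty_simple_path_endless[OF arc_imp_simple_path[OF arcs(2)]] starts finishes by simp
  ultimately show False by blast
qed

text \<open>Otherwise a point inside \<open>c1 \<union> c2\<close> is outside \<open>c1 \<union> c3\<close> and outside \<open>c2 \<union> c3\<close>,
  and since these two curves meet in the connected set \<open>c3\<close>, Janiszewski's theorem joins the
  point to infinity.\<close>

lemma some_arc_inside:
  "path_image c3 \<inter> inside (path_image c1 \<union> path_image c2) \<noteq> {} \<or>
   path_image c2 \<inter> inside (path_image c1 \<union> path_image c3) \<noteq> {} \<or>
   path_image c1 \<inter> inside (path_image c2 \<union> path_image c3) \<noteq> {}"
proof (rule ccontr)
  assume neg: "\<not> ?thesis"
  let ?S = "path_image c1 \<union> path_image c2"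
  let ?T1 = "path_image c1 \<union> path_image c3"
  let ?T2 = "path_image c2 \<union> path_image c3"
  \<comment> \<open>Exchanging \<open>c1\<close> and \<open>c2\<close> turns
    \<open>inside_subset_outside\<close> into the statement about \<open>?T2\<close>.\<close>
  interpret swap: theta a b c2 c1 c3
    using arcs starts finishes disjnt by unfold_locales auto
  note J = Jordan_two_arcs[OF arcs(1) starts(1) finishes(1) arcs(2) starts(2) finishes(2) disjnt(1)]
  note J1 = Jordan_two_arcs[OF arcs(1) starts(1) finishes(1) arcs(3) starts(3) finishes(3) disjnt(2)]
  note J2 = Jordan_two_arcs[OF arcs(2) starts(2) finishes(2) arcs(3) starts(3) finishes(3) disjnt(3)]
  obtain p where p: "p \<in> inside ?S" using J(1) by blast
  have p1: "p \<in> outside ?T1" using p inside_subset_outside neg by blast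
  have p2: "p \<in> outside ?T2" using p swap.inside_subset_outside neg by (auto simp: Un_commute)
  have comp: "compact (path_image c1)" "compact (path_image c2)" "compact (path_image c3)"
    using arcs by (auto simp: compact_arc_image)
  have "outside (?S \<union> path_image c3) \<noteq> {}"
    by (rule outside_bounded_nonempty) (use comp in \<open>auto simp: compact_imp_bounded\<close>)
  \<comment> \<open>\<open>q\<close> plays the role of infinity: a point outside the whole theta
    curve is outside each of its three cycles.\<close>
  then obtain q where "q \<in> outside (?S \<union> path_image c3)" by blast
  then have q: "q \<in> outside ?S" "q \<in> outside ?T1" "q \<in> outside ?T2"
    by (auto intro: subsetD[OF outside_mono, rotated])
  have cc: "connected_component (- T) p q" if "p \<in> outside T" "q \<in> outside T" "connected (outside T)" for T
    unfolding connected_component_def using that outside_no_overlap[of T] by blast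
  have "?T1 \<inter> ?T2 = path_image c3" using disjnt by blast
  then have "connected (?T1 \<inter> ?T2)"
    by (simp add: arcs(3) connected_arc_image)
  then have "connected_component (- (?T1 \<union> ?T2)) p q"
    using comp J1(3) J2(3) p1 p2 q
    by (intro Janiszewski cc) (auto simp: compact_imp_closed compact_Un)
  then have "connected_component (- ?S) p q"
    by (rule connected_component_of_subset) auto
  then have "q \<in> inside ?S" using p inside_same_component by blast
  with q(1) show False using inside_Int_outside by blast
qed

text \<open>One arc enters the inside of the cycle formed by the other two; a cyclic rotation makes
  it the third arc, as \<open>no_connected_set_inside\<close> requires.\<close>

lemma no_connected_set:
  assumes X: "connected X" "X \<inter> (path_image c1 \<union> path_image c2 \<union> path_image c3) = {}"
    and q: "q1 \<in> path_image c1 - {a,b}" "q2 \<in> path_image c2 - {a,b}" "q3 \<in> path_image c3 - {a,b}"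
    and cl: "q1 \<in> closure X" "q2 \<in> closure X" "q3 \<in> closure X"
  shows False
proof -
  interpret r: theta a b c2 c3 c1 by (rule rotate)
  interpret rr: theta a b c3 c1 c2 by (rule r.rotate)
  consider "path_image c3 \<inter> inside (path_image c1 \<union> path_image c2) \<noteq> {}"
    | "path_image c2 \<inter> inside (path_image c3 \<union> path_image c1) \<noteq> {}"
    | "path_image c1 \<inter> inside (path_image c2 \<union> path_image c3) \<noteq> {}"
    using some_arc_inside by (auto simp: Un_commute)
  then show False
  proof cases
    case 1
    then show False using no_connected_set_inside[OF X q cl] by blast
  next
    case 2
    show False
      by (rule rr.no_connected_set_inside[OF X(1) _ q(3,1,2) cl(3,1,2) 2]) (use X(2) in blast)
  next
    case 3
    show False
      by (rule r.no_connected_set_inside[OF X(1) _ q(2,3,1) cl(2,3,1) 3]) (use X(2) in blast)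
  qed
qed

end

section \<open>Nonplanarity of K_{3,3}\<close>

text \<open>By injectivity, the arc without its end is the image of the half-open unit interval.
  Such pieces make up the open star of a vertex in a drawing.\<close>

lemma half_open_arc:
  fixes g :: "real \<Rightarrow> 'a::t2_space"
  assumes "arc g"
  shows "connected (path_image g - {pathfinish g})"
    and "pathfinish g \<in> closure (path_image g - {pathfinish g})"
proof -
  have cont: "continuous_on {0..1} g" and inj: "inj_on g {0..1}"
    using assms by (auto simp: arc_def path_def)
  have "{0..1::real} = insert 1 {0..<1}" by auto
  then have eq: "path_image g - {pathfinish g} = g ` {0..<1}"
    using inj by (auto simp: path_image_def pathfinish_def inj_on_def)
  show "connected (path_image g - {pathfinish g})"
    unfolding eq by (rule connected_continuous_image) (auto intro: continuous_on_subset[OF cont])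
  have "g ` closure {0..<1} \<subseteq> closure (g ` {0..<1})"
    by (rule image_closure_subset) (auto simp: cont closure_subset)
  then show "pathfinish g \<in> closure (path_image g - {pathfinish g})"
    unfolding eq by (auto simp: pathfinish_def)
qed

text \<open>A planar drawing of \<open>K\<^sub>3\<^sub>,\<^sub>3\<close>: two of the \<open>u i\<close> span a theta curve
  through the \<open>v j\<close>, and the open star of the third one reaches all three of its arcs.\<close>

lemma no_planar_K33:
  fixes u v :: "nat \<Rightarrow> complex" and g :: "nat \<Rightarrow> nat \<Rightarrow> real \<Rightarrow> complex"
  assumes arc: "\<And>i j. i < 3 \<Longrightarrow> j < 3 \<Longrightarrow> arc (g i j)"
    and start: "\<And>i j. i < 3 \<Longrightarrow> j < 3 \<Longrightarrow> pathstart (g i j) = u i"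
    and finish: "\<And>i j. i < 3 \<Longrightarrow> j < 3 \<Longrightarrow> pathfinish (g i j) = v j"
    and disj: "\<And>i j k l. i < 3 \<Longrightarrow> j < 3 \<Longrightarrow> k < 3 \<Longrightarrow> l < 3 \<Longrightarrow> (i,j) \<noteq> (k,l) \<Longrightarrow>
      path_image (g i j) \<inter> path_image (g k l) \<subseteq> (if i = k then {u i} else {}) \<union> (if j = l then {v j} else {})"
    and uv: "\<And>i j. i < 3 \<Longrightarrow> j < 3 \<Longrightarrow> u i \<noteq> v j"
  shows False
proof -
  \<comment> \<open>The arc \<open>c j\<close> runs from \<open>u 0\<close> through
    \<open>v j\<close> to \<open>u 1\<close>.\<close>
  define c where "c j = g 0 j +++ reversepath (g 1 j)" for j
  have ends: "u i \<in> path_image (g i j)" "v j \<in> path_image (g i j)" if "i < 3" "j < 3" for i j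
    using start[OF that] finish[OF that] pathstart_in_path_image pathfinish_in_path_image by metis+
  have pic: "path_image (c j) = path_image (g 0 j) \<union> path_image (g 1 j)" if "j < 3" for j
    using that by (simp add: c_def path_image_join start finish)
  have arcc: "Path_Connected.arc (c j)" if "j < 3" for j
    unfolding c_def
    by (rule arc_join) (use that arc start finish disj[of 0 j 1 j] in \<open>auto simp: arc_reversepath\<close>)
  have startc: "pathstart (c j) = u 0" and finishc: "pathfinish (c j) = u 1" if "j < 3" for j
    using that by (auto simp: c_def start)
  have intc: "path_image (c j) \<inter> path_image (c k) = {u 0, u 1}" if "j < 3" "k < 3" "j \<noteq> k" for j k
  proof -
    have "path_image (c j) \<inter> path_image (c k) \<subseteq> {u 0, u 1}"
      using that disj[of 0 j 0 k] disj[of 0 j 1 k] disj[of 1 j 0 k] disj[of 1 j 1 k] by (auto simp: pic)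
    moreover have "{u 0, u 1} \<subseteq> path_image (c j) \<inter> path_image (c k)"
      using that ends by (auto simp: pic)
    ultimately show ?thesis by blast
  qed
  interpret theta "u 0" "u 1" "c 0" "c 1" "c 2"
    by unfold_locales (auto simp: arcc startc finishc intc)
  let ?Y = "\<lambda>j. path_image (g 2 j) - {v j}"
  let ?X = "\<Union>j<3. ?Y j"
  have Y: "connected (?Y j)" "v j \<in> closure (?Y j)" if "j < 3" for j
    using half_open_arc[OF arc[of 2 j]] finish[of 2 j] that by simp_all
  have u2: "u 2 \<in> ?Y j" if "j < 3" for j
    using ends(1)[of 2 j] uv[of 2 j] that by simp
  have "connected ?X"
  proof (rule connected_Union)
    show "connected C" if "C \<in> ?Y ` {..<3}" for C
      using that Y(1) by auto
    have "u 2 \<in> \<Inter> (?Y ` {..<3})" using u2 by auto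
    then show "\<Inter> (?Y ` {..<3}) \<noteq> {}" by blast
  qed
  moreover have "?X \<inter> (path_image (c 0) \<union> path_image (c 1) \<union> path_image (c 2)) = {}"
  proof -
    \<comment> \<open>An edge at \<open>u 2\<close> can meet an edge at \<open>u 0\<close> or
      \<open>u 1\<close> only in a common end \<open>v j\<close>, and these tips are removed from
      \<open>?X\<close>.\<close>
    have "x = v j" if "i < 2" "j < 3" "k < 3" "x \<in> path_image (g 2 j)" "x \<in> path_image (g i k)" for i j k x
      using disj[of 2 j i k] that by (auto split: if_splits)
    from this[of 0] this[of 1] have "?X \<inter> path_image (c k) = {}" if "k < 3" for k
      unfolding pic[OF that] using that by auto
    then show ?thesis by (simp add: Int_Un_distrib)
  qed
  moreover have "v j \<in> path_image (c j) - {u 0, u 1}" if "j < 3" for j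
    using that ends(2)[of 0 j] uv[of 0 j] uv[of 1 j] by (auto simp: pic)
  moreover have "v j \<in> closure ?X" if "j < 3" for j
    using Y(2)[OF that] closure_mono[of "?Y j" ?X] that by blast
  ultimately show False
    using no_connected_set[of ?X "v 0" "v 1" "v 2"] by simp
qed

section \<open>Degree sums without K_{3,3} and S_{2,5}\<close>

text \<open>Choose \<open>A'\<close> to avoid \<open>B\<close> as far as possible: either it costs
  \<open>B\<close> nothing, or it contains \<open>A - B\<close>, and then \<open>B - A'\<close> is
  all of the union except \<open>m\<close> elements.\<close>

lemma disjoint_subsets_of_cards:
  assumes "finite A" "finite B" "m \<le> card A" "k \<le> card B" "m + k \<le> card (A \<union> B)"
  obtains A' B' where "A' \<subseteq> A" "B' \<subseteq> B" "A' \<inter> B' = {}" "card A' = m" "card B' = k"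
proof -
  have "\<exists>A'\<subseteq>A. card A' = m \<and> k \<le> card (B - A')"
  proof (cases "m \<le> card (A - B)")
    case True
    then obtain A' where A': "A' \<subseteq> A - B" "card A' = m"
      using obtain_subset_with_card_n by metis
    then have "B - A' = B" by blast
    with A' assms(4) show ?thesis by (intro exI[of _ A']) auto
  next
    case False
    then obtain A' where A': "A - B \<subseteq> A'" "A' \<subseteq> A" "card A' = m"
      using exists_subset_between[of "A - B" m A] assms by auto
    have "card (B - A') = card (A \<union> B - A')"
      using A' by (intro arg_cong[of _ _ card]) auto
    also have "\<dots> = card (A \<union> B) - m"
      using A' assms by (subst card_Diff_subset) (auto intro: finite_subset)
    finally show ?thesis using A' assms(5) by auto
  qed
  then obtain A' where A': "A' \<subseteq> A" "card A' = m" "k \<le> card (B - A')" by blast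
  obtain B' where "B' \<subseteq> B - A'" "card B' = k"
    using obtain_subset_with_card_n[OF A'(3)] by metis
  with A' show ?thesis by (intro that[of A' B']) auto
qed

text \<open>The graph is given by its neighbourhood function on the whole type. Induced subgraphs
  are represented by a vertex set \<open>W\<close> passed to \<open>deg\<close>, so deleting
  vertices leaves the assumptions untouched.\<close>

locale K33_S25_free =
  fixes N :: "'a \<Rightarrow> 'a set"
  assumes sym: "u \<in> N v \<longleftrightarrow> v \<in> N u"
    and irrefl: "v \<notin> N v"
    and no_K33: "card A = 3 \<Longrightarrow> card B = 3 \<Longrightarrow> (\<And>a. a \<in> A \<Longrightarrow> B \<subseteq> N a) \<Longrightarrow> False"
    and no_S25: "x \<in> N y \<Longrightarrow> A \<subseteq> N x - {y} \<Longrightarrow> B \<subseteq> N y - {x} \<Longrightarrow> A \<inter> B = {} \<Longrightarrow>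
      card A = 2 \<Longrightarrow> card B = 5 \<Longrightarrow> False"
begin

definition deg :: "'a set \<Rightarrow> 'a \<Rightarrow> nat" where
  "deg W v = card (N v \<inter> W)"

text \<open>Besides the backbone, \<open>x\<close> has at least 2 and \<open>y\<close> at least 5
  neighbours in \<open>W\<close>. If these were 7 vertices together, disjoint leaf sets of sizes 2
  and 5 could be chosen.\<close>

lemma no_double_star:
  assumes "finite W" "x \<in> N y" "x \<in> W" "y \<in> W" "3 \<le> deg W x" "6 \<le> deg W y"
  shows "card (N x \<inter> W - {y} \<union> (N y \<inter> W - {x})) \<le> 6"
proof (rule ccontr)
  let ?A = "N x \<inter> W - {y}" and ?B = "N y \<inter> W - {x}"
  assume neg: "\<not> ?thesis"
  have "card ?A = deg W x - 1" "card ?B = deg W y - 1"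
    using assms sym by (auto simp: deg_def)
  then have "2 \<le> card ?A" "5 \<le> card ?B" "2 + 5 \<le> card (?A \<union> ?B)"
    using assms(5,6) neg by linarith+
  then obtain A B where "A \<subseteq> ?A" "B \<subseteq> ?B" "A \<inter> B = {}" "card A = 2" "card B = 5"
    using disjoint_subsets_of_cards[of ?A ?B 2 5] assms(1) by blast
  then show False using no_S25[of x y A B] assms(2) by blast
qed

lemma deg_le_7:
  assumes "finite W" "\<And>x. x \<in> W \<Longrightarrow> 3 \<le> deg W x" "y \<in> W"
  shows "deg W y \<le> 7"
proof (rule ccontr)
  assume neg: "\<not> ?thesis"
  then obtain x where x: "x \<in> N y" "x \<in> W"
    unfolding deg_def by (metis IntD1 IntD2 card.empty equals0I zero_le)
  have "deg W y - 1 = card (N y \<inter> W - {x})"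
    using x assms by (auto simp: deg_def)
  also have "\<dots> \<le> card (N x \<inter> W - {y} \<union> (N y \<inter> W - {x}))"
    using assms by (intro card_mono) auto
  also have "\<dots> \<le> 6"
    using no_double_star[OF assms(1) x assms(3)] assms x neg by auto
  finally show False using neg by linarith
qed

text \<open>The six neighbours of \<open>y\<close> other than \<open>x\<close> already exhaust the
  bound of \<open>no_double_star\<close>, so \<open>x\<close> can contribute no new vertex.\<close>

lemma neighbours_closed:
  assumes "finite W" "\<And>x. x \<in> W \<Longrightarrow> 3 \<le> deg W x" "y \<in> W" "deg W y = 7" "x \<in> N y" "x \<in> W"
  shows "N x \<inter> W \<subseteq> insert y (N y)"
proof -
  have "card (N x \<inter> W - {y} \<union> (N y \<inter> W - {x})) \<le> card (N y \<inter> W - {x})"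
    using no_double_star[OF assms(1,5,6,3)] assms by (auto simp: deg_def)
  then have "N y \<inter> W - {x} = N x \<inter> W - {y} \<union> (N y \<inter> W - {x})"
    using assms(1) by (intro card_seteq) auto
  then show ?thesis by blast
qed

text \<open>By \<open>K\<^sub>3\<^sub>,\<^sub>3\<close>-freeness no two neighbours of \<open>y\<close> have three common neighbours
  inside the neighbourhood of \<open>y\<close>.\<close>

lemma sum_link_degrees:
  fixes y W
  assumes "finite W"
  defines "H \<equiv> N y \<inter> W"
  shows "(\<Sum>x\<in>H. deg H x * (deg H x - 1)) \<le> 2 * (card H * (card H - 1))"
proof -
  have fin: "finite H" using assms by (simp add: H_def)
  \<comment> \<open>Double counting of triples: \<open>x\<close> in \<open>H\<close> with an ordered
    pair of distinct neighbours \<open>a\<close>, \<open>b\<close> of \<open>x\<close> in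
    \<open>H\<close>.\<close>
  have "(\<Sum>x\<in>H. deg H x * (deg H x - 1)) = (\<Sum>x\<in>H. \<Sum>a\<in>H. \<Sum>b\<in>H-{a}. of_bool (a \<in> N x \<and> b \<in> N x))"
  proof (rule sum.cong[OF refl])
    fix x assume "x \<in> H"
    have "(\<Sum>a\<in>H. \<Sum>b\<in>H-{a}. of_bool (a \<in> N x \<and> b \<in> N x)) =
      (\<Sum>a\<in>H. if a \<in> N x then deg H x - 1 else 0)"
    proof (rule sum.cong[OF refl])
      fix a assume a: "a \<in> H"
      have "(\<Sum>b\<in>H-{a}. of_bool (a \<in> N x \<and> b \<in> N x)) = card {b\<in>H-{a}. a \<in> N x \<and> b \<in> N x}"
        using fin by (simp add: Int_def)
      also have "\<dots> = (if a \<in> N x then card (N x \<inter> H - {a}) else 0)"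
        by (auto intro: arg_cong[of _ _ card])
      finally show "(\<Sum>b\<in>H-{a}. of_bool (a \<in> N x \<and> b \<in> N x)) = (if a \<in> N x then deg H x - 1 else 0)"
        using a fin by (auto simp: deg_def)
    qed
    also have "\<dots> = card (H \<inter> N x) * (deg H x - 1)"
      using fin by (simp add: sum.If_cases Int_def)
    finally show "deg H x * (deg H x - 1) = (\<Sum>a\<in>H. \<Sum>b\<in>H-{a}. of_bool (a \<in> N x \<and> b \<in> N x))"
      by (simp add: deg_def Int_commute)
  qed
  also have "\<dots> = (\<Sum>a\<in>H. \<Sum>x\<in>H. \<Sum>b\<in>H-{a}. of_bool (a \<in> N x \<and> b \<in> N x))"
    by (rule sum.swap)
  also have "\<dots> = (\<Sum>a\<in>H. \<Sum>b\<in>H-{a}. \<Sum>x\<in>H. of_bool (a \<in> N x \<and> b \<in> N x))"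
    by (rule sum.cong[OF refl], rule sum.swap)
  also have "\<dots> \<le> (\<Sum>a\<in>H. \<Sum>b\<in>H-{a}. 2)"
  proof (rule sum_mono, rule sum_mono)
    fix a b assume a: "a \<in> H" and b: "b \<in> H - {a}"
    have "card {x\<in>H. a \<in> N x \<and> b \<in> N x} \<le> 2"
    proof (rule ccontr)
      assume "\<not> ?thesis"
      then have "3 \<le> card {x\<in>H. a \<in> N x \<and> b \<in> N x}" by simp
      then obtain B where B: "B \<subseteq> {x\<in>H. a \<in> N x \<and> b \<in> N x}" "card B = 3"
        by (rule obtain_subset_with_card_n)
      have "card {y,a,b} = 3"
        using a b irrefl by (auto simp: H_def card_insert_if)
      moreover have "B \<subseteq> N c" if "c \<in> {y,a,b}" for c
        using that B(1) sym[of _ c] by (auto simp: H_def)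
      ultimately show False
        using no_K33[of "{y,a,b}" B] B(2) by blast
    qed
    moreover have "(\<Sum>x\<in>H. of_bool (a \<in> N x \<and> b \<in> N x)) = card {x\<in>H. a \<in> N x \<and> b \<in> N x}"
      using fin by (simp add: Int_def)
    ultimately show "(\<Sum>x\<in>H. of_bool (a \<in> N x \<and> b \<in> N x)) \<le> (2::nat)"
      by linarith
  qed
  also have "\<dots> = 2 * (card H * (card H - 1))"
    using fin by simp
  finally show ?thesis .
qed

lemma deg_eq_sum: "finite W \<Longrightarrow> deg W v = (\<Sum>u\<in>W. of_bool (u \<in> N v))"
  by (simp add: deg_def Int_def conj_commute)

lemma sum_deg_swap:
  assumes "finite U" "finite W"
  shows "(\<Sum>v\<in>U. deg W v) = (\<Sum>v\<in>W. deg U v)"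
proof -
  have "(\<Sum>v\<in>U. deg W v) = (\<Sum>v\<in>U. \<Sum>u\<in>W. of_bool (u \<in> N v))"
    using assms by (simp add: deg_eq_sum)
  also have "\<dots> = (\<Sum>u\<in>W. \<Sum>v\<in>U. of_bool (v \<in> N u))"
    by (subst sum.swap) (simp add: sym)
  finally show ?thesis using assms by (simp add: deg_eq_sum)
qed

text \<open>Each edge between \<open>U\<close> and \<open>W - U\<close> is counted at both of its
  ends, hence the factor 2.\<close>

lemma sum_deg_remove:
  assumes "finite W" "U \<subseteq> W"
  shows "(\<Sum>v\<in>W. deg W v) =
    (\<Sum>v\<in>W - U. deg (W - U) v) + 2 * (\<Sum>v\<in>U. deg (W - U) v) + (\<Sum>v\<in>U. deg U v)"
proof -
  have fin: "finite U" "finite (W - U)" using assms by (auto intro: finite_subset)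
  have split: "deg W v = deg (W - U) v + deg U v" for v
    unfolding deg_eq_sum[OF assms(1)] deg_eq_sum[OF fin(1)] deg_eq_sum[OF fin(2)]
    by (rule sum.subset_diff[OF assms(2,1)])
  have "(\<Sum>v\<in>W. deg W v) = (\<Sum>v\<in>W - U. deg W v) + (\<Sum>v\<in>U. deg W v)"
    by (rule sum.subset_diff[OF assms(2,1)])
  also have "(\<Sum>v\<in>W - U. deg W v) = (\<Sum>v\<in>W - U. deg (W - U) v) + (\<Sum>v\<in>U. deg (W - U) v)"
    using sum_deg_swap[OF fin(2,1)] by (simp add: split sum.distrib)
  finally show ?thesis by (simp add: split sum.distrib)
qed

text \<open>The five neighbours of \<open>y\<close> other than \<open>x\<close> leave room for at
  most one vertex in \<open>R\<close> under the bound 6. The summand 2 accounts for \<open>y\<close>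
  and that vertex.\<close>

lemma deg_link_ge:
  assumes "finite W" "\<And>x. x \<in> W \<Longrightarrow> 3 \<le> deg W x" "y \<in> W" "deg W y = 6" "x \<in> N y" "x \<in> W"
  shows "deg W x \<le> deg (N y \<inter> W) x + 2"
proof -
  define R where "R = N x \<inter> W - {y} - N y"
  have fin: "finite R" using assms by (simp add: R_def)
  have "N x \<inter> W - {y} \<union> (N y \<inter> W - {x}) = R \<union> (N y \<inter> W - {x})"
    using irrefl by (auto simp: R_def)
  moreover have "card (N x \<inter> W - {y} \<union> (N y \<inter> W - {x})) \<le> 6"
    by (rule no_double_star) (use assms in auto)
  moreover have "card (R \<union> (N y \<inter> W - {x})) = card R + card (N y \<inter> W - {x})"
    using assms fin by (intro card_Un_disjoint) (auto simp: R_def)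
  moreover have "card (N y \<inter> W - {x}) = 5"
    using assms by (simp add: deg_def)
  ultimately have "card R \<le> 1" by simp
  moreover have "N x \<inter> W = insert y (N x \<inter> (N y \<inter> W) \<union> R)"
    using assms sym[of x y] by (auto simp: R_def)
  then have "deg W x \<le> Suc (card (N x \<inter> (N y \<inter> W) \<union> R))"
    unfolding deg_def using assms(1) fin by (simp add: card_insert_if)
  ultimately show ?thesis
    using card_Un_le[of "N x \<inter> (N y \<inter> W)" R] by (simp add: deg_def)
qed

text \<open>The charge that a vertex of degree \<open>d\<close> sends to each of its neighbours.\<close>

definition charge :: "nat \<Rightarrow> nat" where
  "charge d = (if 6 \<le> d then 0 else if d = 5 then 1 else 2)"

text \<open>Let h be the degree of a neighbour within the link of \<open>y\<close>. By
  \<open>deg_link_ge\<close>, degree at least 6 forces h(h-1) to be at least 12, degree 5 forces at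
  least 6, and the factor 6 on the charge fills each deficit up to 12. The six neighbours total at
  least 72, the link accounts for at most 60, so six times the charge is at least 12.\<close>

lemma charge_received:
  assumes "finite W" "\<And>x. x \<in> W \<Longrightarrow> 3 \<le> deg W x" "y \<in> W" "deg W y = 6"
  shows "2 \<le> (\<Sum>x\<in>N y \<inter> W. charge (deg W x))"
proof -
  let ?H = "N y \<inter> W"
  have "12 \<le> deg ?H x * (deg ?H x - 1) + 6 * charge (deg W x)" if "x \<in> ?H" for x
  proof -
    have h: "deg W x \<le> deg ?H x + 2" using deg_link_ge[OF assms] that by blast
    consider "6 \<le> deg W x" | "deg W x = 5" | "deg W x < 5" by linarith
    then show ?thesis
    proof cases
      case 1
      with h have "4 * 3 \<le> deg ?H x * (deg ?H x - 1)" by (intro mult_mono) auto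
      then show ?thesis by simp
    next
      case 2
      with h have "3 * 2 \<le> deg ?H x * (deg ?H x - 1)" by (intro mult_mono) auto
      then show ?thesis using 2 by (simp add: charge_def)
    qed (simp add: charge_def)
  qed
  then have "(\<Sum>x\<in>?H. 12) \<le> (\<Sum>x\<in>?H. deg ?H x * (deg ?H x - 1) + 6 * charge (deg W x))"
    by (rule sum_mono)
  then have "72 \<le> (\<Sum>x\<in>?H. deg ?H x * (deg ?H x - 1)) + 6 * (\<Sum>x\<in>?H. charge (deg W x))"
    using assms(4) by (simp add: deg_def sum.distrib sum_distrib_left)
  moreover have "(\<Sum>x\<in>?H. deg ?H x * (deg ?H x - 1)) \<le> 60"
    using sum_link_degrees[OF assms(1), of y] assms(4) by (simp add: deg_def)
  ultimately show ?thesis by linarith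
qed

lemma degree_sum_bound_discharging:
  assumes "finite W" "\<And>x. x \<in> W \<Longrightarrow> 3 \<le> deg W x" "\<And>x. x \<in> W \<Longrightarrow> deg W x \<le> 6"
  shows "7 * (\<Sum>v\<in>W. deg W v) \<le> 40 * card W"
proof -
  let ?r = "\<lambda>v. charge (deg W v)"
  have "(\<Sum>y\<in>W. if deg W y = 6 then 2 else 0) \<le> (\<Sum>y\<in>W. \<Sum>x\<in>N y \<inter> W. ?r x)"
    by (intro sum_mono) (use charge_received[OF assms(1,2)] in auto)
  also have "\<dots> = (\<Sum>y\<in>W. \<Sum>x\<in>W. if x \<in> N y then ?r x else 0)"
    using assms(1) by (simp add: sum.inter_restrict Int_commute)
  also have "\<dots> = (\<Sum>x\<in>W. \<Sum>y\<in>W. if y \<in> N x then ?r x else 0)"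
    by (subst sum.swap) (simp add: sym)
  also have "\<dots> = (\<Sum>x\<in>W. deg W x * ?r x)"
    using assms(1) by (simp add: sum.inter_restrict[symmetric] deg_def Int_commute)
  finally have sent: "(\<Sum>y\<in>W. if deg W y = 6 then 2 else 0) \<le> (\<Sum>x\<in>W. deg W x * ?r x)" .
  \<comment> \<open>Seven times the degree plus the charge sent is at most 40, or 42 at degree 6,
    where the surplus 2 is paid by the charge received. Equality holds at degrees 5 and 6.\<close>
  have "7 * deg W v + 2 + deg W v * ?r v \<le> 42 + (if deg W v = 6 then 2 else 0)" if "v \<in> W" for v
  proof -
    have "deg W v \<in> {3,4,5,6}" using assms(2,3)[OF that] by auto
    then show ?thesis by (auto simp: charge_def)
  qed
  then have "(\<Sum>v\<in>W. 7 * deg W v + 2 + deg W v * ?r v) \<le> (\<Sum>v\<in>W. 42 + (if deg W v = 6 then 2 else 0))"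
    by (rule sum_mono)
  with sent show ?thesis by (simp add: sum.distrib sum_Suc flip: sum_distrib_left)
qed

lemma degree_sum_bound_closed_nbhd:
  assumes "finite W" "\<And>x. x \<in> W \<Longrightarrow> 3 \<le> deg W x" "y \<in> W" "deg W y = 7"
  defines "U \<equiv> insert y (N y \<inter> W)"
  shows "(\<Sum>v\<in>U. deg (W - U) v) = 0" "7 * (\<Sum>v\<in>U. deg U v) \<le> 40 * card U"
proof -
  let ?H = "N y \<inter> W"
  have closed: "N x \<inter> W \<subseteq> U" if "x \<in> U" for x
    using neighbours_closed[OF assms(1-4), of x] that by (auto simp: U_def)
  then have "N x \<inter> (W - U) = {}" if "x \<in> U" for x
    using that by blast
  then show "(\<Sum>v\<in>U. deg (W - U) v) = 0"
    by (simp add: deg_def)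
  have fin: "finite ?H" and card: "card ?H = 7" and y: "y \<notin> ?H"
    using assms irrefl by (auto simp: deg_def)
  have cardU: "card U = 8" using fin card y by (simp add: U_def)
  \<comment> \<open>This is (h-4)^2 >= 0, centred at 4, the largest average link degree it then
    allows: seven times the link degree sum is at most 84 + 112 = 196.\<close>
  have "7 * deg ?H x \<le> deg ?H x * (deg ?H x - 1) + 16" for x
  proof -
    have "0 \<le> (int (deg ?H x) - 4)\<^sup>2" by simp
    then have "7 * int (deg ?H x) \<le> int (deg ?H x) * (int (deg ?H x) - 1) + 16"
      by (simp add: power2_eq_square algebra_simps)
    then show ?thesis
      by (cases "deg ?H x") (auto simp flip: of_nat_mult simp: algebra_simps)
  qed
  then have "(\<Sum>x\<in>?H. 7 * deg ?H x) \<le> (\<Sum>x\<in>?H. deg ?H x * (deg ?H x - 1) + 16)"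
    by (intro sum_mono)
  also have "\<dots> \<le> 84 + 112"
    using sum_link_degrees[OF assms(1), of y] card by (simp add: sum.distrib)
  finally have H: "(\<Sum>x\<in>?H. deg ?H x) \<le> 28" by (simp flip: sum_distrib_left)
  have "deg U y = 7"
    unfolding deg_def using card irrefl by (simp add: U_def Int_insert_right Int_assoc[symmetric])
  moreover have "deg U x = Suc (deg ?H x)" if "x \<in> ?H" for x
    using that fin y sym[of x y] by (auto simp: U_def deg_def Int_insert_right)
  \<comment> \<open>The 14 counts the seven edges at \<open>y\<close> twice. The total is at most
    42, and 7 times 42 is 294, below 40 times 8.\<close>
  ultimately have "(\<Sum>v\<in>U. deg U v) = 14 + (\<Sum>x\<in>?H. deg ?H x)"
    using fin y card unfolding U_def by (simp add: sum_Suc)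
  with H cardU show "7 * (\<Sum>v\<in>U. deg U v) \<le> 40 * card U" by simp
qed

lemma degree_sum_bound:
  assumes "finite W"
  shows "7 * (\<Sum>v\<in>W. deg W v) \<le> 40 * card W"
  using assms
proof (induction W rule: finite_psubset_induct)
  case (psubset W)
  \<comment> \<open>Deleting \<open>U\<close> is harmless if it lowers the degree sum by at most
    40/7 per deleted vertex.\<close>
  have reduce: ?case
    if U: "U \<subseteq> W" "U \<noteq> {}" and small: "7 * (2 * (\<Sum>v\<in>U. deg (W - U) v) + (\<Sum>v\<in>U. deg U v)) \<le> 40 * card U"
    for U
  proof -
    have "7 * (\<Sum>v\<in>W - U. deg (W - U) v) \<le> 40 * card (W - U)"
      using psubset.IH[of "W - U"] U by blast
    moreover have "card W = card (W - U) + card U"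
      using psubset.hyps U(1) by (simp add: card_Diff_subset card_mono finite_subset)
    ultimately show ?thesis
      using small sum_deg_remove[OF psubset.hyps U(1)] by simp
  qed
  consider v where "v \<in> W" "deg W v \<le> 2"
    | y where "\<And>x. x \<in> W \<Longrightarrow> 3 \<le> deg W x" "y \<in> W" "deg W y = 7"
    | "\<And>x. x \<in> W \<Longrightarrow> 3 \<le> deg W x" "\<And>x. x \<in> W \<Longrightarrow> deg W x \<le> 6"
  proof (cases "\<exists>v\<in>W. deg W v \<le> 2")
    case False
    then have ge: "3 \<le> deg W x" if "x \<in> W" for x
      using that by force
    then have "deg W x \<le> 6 \<or> deg W x = 7" if "x \<in> W" for x
      using deg_le_7[OF psubset.hyps ge that] by linarith
    with ge that show ?thesis by blast
  qed (use that in blast)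
  then show ?case
  proof cases
    case (1 v)
    \<comment> \<open>Deleting \<open>v\<close> lowers the degree sum by at most 4, and 28 is below
      40.\<close>
    have "N v \<inter> (W - {v}) = N v \<inter> W" "N v \<inter> {v} = {}" using irrefl by auto
    then have "deg (W - {v}) v = deg W v" "deg {v} v = 0" by (auto simp: deg_def)
    then show ?thesis using 1 by (intro reduce[of "{v}"]) auto
  next
    case (2 y)
    note * = degree_sum_bound_closed_nbhd[OF psubset.hyps 2]
    show ?thesis by (rule reduce[of "insert y (N y \<inter> W)"]) (use * 2 in simp_all)
  next
    case 3
    then show ?thesis using degree_sum_bound_discharging[OF psubset.hyps] by blast
  qed
qed

end

section \<open>From planar drawings to the degree bound\<close>

text \<open>Edges are unordered, so a drawn edge may run either way, whereas
  \<open>no_planar_K33\<close> needs every arc to start on the same side.\<close>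

definition orient :: "complex \<Rightarrow> (real \<Rightarrow> complex) \<Rightarrow> real \<Rightarrow> complex" where
  "orient x g = (if pathstart g = x then g else reversepath g)"

lemma orient:
  assumes "arc g" "{pathstart g, pathfinish g} = {x, y}"
  shows "arc (orient x g)" "pathstart (orient x g) = x" "pathfinish (orient x g) = y"
    "path_image (orient x g) = path_image g"
  using assms by (auto simp: orient_def arc_reversepath doubleton_eq_iff)

lemma planarE:
  fixes V :: "'a set"
  assumes "planar V E"
  obtains p :: "'a \<Rightarrow> complex" and \<gamma> where "inj_on p V"
    and "\<And>u v. {u, v} \<in> E \<Longrightarrow> arc (\<gamma> {u, v})"
    and "\<And>u v. {u, v} \<in> E \<Longrightarrow> {pathstart (\<gamma> {u, v}), pathfinish (\<gamma> {u, v})} = {p u, p v}"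
    and "\<And>e f. e \<in> E \<Longrightarrow> f \<in> E \<Longrightarrow> e \<noteq> f \<Longrightarrow>
      path_image (\<gamma> e) \<inter> path_image (\<gamma> f) \<subseteq> p ` (e \<inter> f)"
  using assms unfolding planar_def
proof (elim exE)
  fix p :: "'a \<Rightarrow> complex" and \<gamma>
  assume drawing: "inj_on p V \<and>
        (\<forall>u v. {u, v} \<in> E \<longrightarrow>
            arc (\<gamma> {u, v}) \<and>
            {pathstart (\<gamma> {u, v}), pathfinish (\<gamma> {u, v})} = {p u, p v} \<and>
            path_image (\<gamma> {u, v}) \<inter> p ` V = {p u, p v}) \<and>
        (\<forall>e\<in>E. \<forall>f\<in>E. e \<noteq> f \<longrightarrow>
            path_image (\<gamma> e) \<inter> path_image (\<gamma> f) \<subseteq> p ` (e \<inter> f))"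
  show thesis
    by (rule that[of p \<gamma>]) (use drawing in simp_all)
qed

lemma planar_no_K33:
  fixes V :: "'a set"
  assumes planar: "planar V E" and AB: "A \<subseteq> V" "B \<subseteq> V" "A \<inter> B = {}" and card: "card A = 3" "card B = 3"
    and edges: "\<And>a b. a \<in> A \<Longrightarrow> b \<in> B \<Longrightarrow> {a, b} \<in> E"
  shows False
  using planar
proof (rule planarE)
  fix p :: "'a \<Rightarrow> complex" and \<gamma>
  assume p: "inj_on p V"
    and \<gamma>: "\<And>u v. {u, v} \<in> E \<Longrightarrow> arc (\<gamma> {u, v})"
      "\<And>u v. {u, v} \<in> E \<Longrightarrow> {pathstart (\<gamma> {u, v}), pathfinish (\<gamma> {u, v})} = {p u, p v}"
    and cross: "\<And>e f. e \<in> E \<Longrightarrow> f \<in> E \<Longrightarrow> e \<noteq> f \<Longrightarrow>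
      path_image (\<gamma> e) \<inter> path_image (\<gamma> f) \<subseteq> p ` (e \<inter> f)"
  have "finite A" "finite B" using card by (auto intro: card_ge_0_finite)
  then obtain a b where "bij_betw a {0..<card A} A" "bij_betw b {0..<card B} B"
    by (meson ex_bij_betw_nat_finite)
  then have inj: "inj_on a {..<3}" "inj_on b {..<3}"
    and ab: "\<And>i. i < 3 \<Longrightarrow> a i \<in> A" "\<And>i. i < 3 \<Longrightarrow> b i \<in> B"
    unfolding card by (auto simp: bij_betw_def atLeast0LessThan)
  define g where "g i j = orient (p (a i)) (\<gamma> {a i, b j})" for i j
  have g: "arc (g i j)" "pathstart (g i j) = p (a i)" "pathfinish (g i j) = p (b j)"
    "path_image (g i j) = path_image (\<gamma> {a i, b j})" if "i < 3" "j < 3" for i j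
    unfolding g_def using orient[OF \<gamma>[OF edges[OF ab(1)[OF that(1)] ab(2)[OF that(2)]]]] by auto
  have neq: "a i \<noteq> b j" if "i < 3" "j < 3" for i j
    using ab(1)[OF that(1)] ab(2)[OF that(2)] AB(3) by auto
  show False
  proof (rule no_planar_K33[of g "p \<circ> a" "p \<circ> b"])
    fix i j k l :: nat
    assume l: "i < 3" "j < 3" "k < 3" "l < 3" "(i, j) \<noteq> (k, l)"
    let ?R = "(if i = k then {a i} else {}) \<union> (if j = l then {b j} else {})"
    \<comment> \<open>Since the two sides are disjoint, an edge determines its end on each side, and
      hence its index pair.\<close>
    have "{a i, b j} \<noteq> {a k, b l}"
      using inj neq[of i l] l by (auto simp: inj_on_def doubleton_eq_iff)
    moreover have "{a i, b j} \<in> E" "{a k, b l} \<in> E"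
      using edges ab l by simp_all
    ultimately have "path_image (g i j) \<inter> path_image (g k l) \<subseteq> p ` ({a i, b j} \<inter> {a k, b l})"
      using cross l g(4) by simp
    also have "{a i, b j} \<inter> {a k, b l} \<subseteq> ?R"
      using inj neq[of i l] neq[of k j] l(1-4) by (auto simp: inj_on_def)
    also have "p ` ?R = (if i = k then {(p \<circ> a) i} else {}) \<union> (if j = l then {(p \<circ> b) j} else {})"
      by simp
    finally show "path_image (g i j) \<inter> path_image (g k l) \<subseteq>
        (if i = k then {(p \<circ> a) i} else {}) \<union> (if j = l then {(p \<circ> b) j} else {})"
      by blast
  next
    fix i j :: nat assume "i < 3" "j < 3"
    then have "a i \<in> V" "b j \<in> V" "a i \<noteq> b j"
      using ab neq AB by auto
    then show "(p \<circ> a) i \<noteq> (p \<circ> b) j"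
      using p by (simp add: inj_on_eq_iff)
  qed (use g in auto)
qed

lemma contains_double_star:
  assumes "finite A" "finite B" "insert x (insert y (A \<union> B)) \<subseteq> V"
    and "x \<noteq> y" "x \<notin> A \<union> B" "y \<notin> A \<union> B" "A \<inter> B = {}"
    and edges: "{x, y} \<in> E" "\<And>a. a \<in> A \<Longrightarrow> {x, a} \<in> E" "\<And>b. b \<in> B \<Longrightarrow> {y, b} \<in> E"
  shows "contains_copy V E (double_star_V (card A) (card B)) (double_star_E (card A) (card B))"
proof -
  obtain as bs where as: "set as = A" "distinct as" and bs: "set bs = B" "distinct bs"
    using assms(1,2) finite_distinct_list by metis
  then have len: "length as = card A" "length bs = card B" by (metis distinct_card)+
  \<comment> \<open>This list order matches the numbering of the double star: 0 and 1 are the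
    backbone, followed by the leaves of 0 and then those of 1.\<close>
  define f where "f = nth (x # y # as @ bs)"
  have f: "f 0 = x" "f 1 = y" by (auto simp: f_def)
  have fA: "f i \<in> A" if "i \<in> {2..card A + 1}" for i
  proof -
    have "f i = as ! (i - 2)" using that len by (auto simp: f_def nth_append nth_Cons' numeral_2_eq_2)
    moreover have "i - 2 < length as" using that len by auto
    ultimately show ?thesis using as nth_mem by metis
  qed
  have fB: "f i \<in> B" if "i \<in> {card A + 2..card A + card B + 1}" for i
  proof -
    have "f i = bs ! (i - 2 - card A)" using that len by (auto simp: f_def nth_append nth_Cons' numeral_2_eq_2)
    moreover have "i - 2 - card A < length bs" using that len by auto
    ultimately show ?thesis using bs nth_mem by metis
  qed
  have dV: "i < length (x # y # as @ bs)" if "i \<in> double_star_V (card A) (card B)" for i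
    using that len by (auto simp: double_star_V_def)
  have "inj_on f (double_star_V (card A) (card B))"
    unfolding f_def by (rule inj_on_nth) (use assms as bs dV in auto)
  moreover have "f ` double_star_V (card A) (card B) \<subseteq> V"
  proof
    fix z assume "z \<in> f ` double_star_V (card A) (card B)"
    then have "z \<in> set (x # y # as @ bs)"
      unfolding f_def using dV nth_mem by blast
    then show "z \<in> V" using assms(3) as bs by auto
  qed
  moreover have "f ` e \<in> E" if "e \<in> double_star_E (card A) (card B)" for e
    using that unfolding double_star_E_def by (auto simp: f[unfolded One_nat_def] fA fB edges)
  ultimately show ?thesis unfolding contains_copy_def by blast
qed

lemma sum_degrees:
  assumes "simple_graph V E"
  shows "(\<Sum>v\<in>V. card ({u. {v, u} \<in> E} \<inter> V)) = 2 * card E"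
proof -
  have V: "finite V" and E: "\<And>e. e \<in> E \<Longrightarrow> \<exists>u v. u \<noteq> v \<and> u \<in> V \<and> v \<in> V \<and> e = {u, v}"
    using assms by (auto simp: simple_graph_def)
  have "E \<subseteq> Pow V" using E by blast
  then have "finite E" using V by (simp add: finite_subset)
  have "card ({u. {v, u} \<in> E} \<inter> V) = card {e \<in> E. v \<in> e}" for v
  proof (rule bij_betw_same_card)
    show "bij_betw (\<lambda>u. {v, u}) ({u. {v, u} \<in> E} \<inter> V) {e \<in> E. v \<in> e}"
      unfolding bij_betw_def
    proof
      show "(\<lambda>u. {v, u}) ` ({u. {v, u} \<in> E} \<inter> V) = {e \<in> E. v \<in> e}"
        using E by (fastforce simp: insert_commute)
    qed (auto simp: inj_on_def doubleton_eq_iff)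
  qed
  moreover have "(\<Sum>v\<in>V. card {e \<in> E. v \<in> e}) = 2 * card E"
  proof (rule sum_multicount[OF V \<open>finite E\<close>], rule ballI)
    fix e assume "e \<in> E"
    then obtain u v where "u \<noteq> v" "u \<in> V" "v \<in> V" "e = {u, v}" using E by blast
    then have "{w \<in> V. w \<in> e} = {u, v}" "u \<noteq> v" by auto
    then show "card {w \<in> V. w \<in> e} = 2" by simp
  qed
  ultimately show ?thesis by simp
qed

lemma planar_S25_free_edges:
  assumes simple: "simple_graph V E" and planar: "planar V E"
    and free: "\<not> contains_copy V E (double_star_V 2 5) (double_star_E 2 5)"
  shows "7 * card E \<le> 20 * card V"
proof -
  have V: "finite V" and E: "\<And>e. e \<in> E \<Longrightarrow> \<exists>u v. u \<noteq> v \<and> u \<in> V \<and> v \<in> V \<and> e = {u, v}"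
    using simple by (auto simp: simple_graph_def)
  have EV: "u \<in> V" "v \<in> V" "u \<noteq> v" if "{u, v} \<in> E" for u v
    using E[OF that] by (auto simp: doubleton_eq_iff)
  interpret K33_S25_free "\<lambda>v. {u. {v, u} \<in> E}"
  proof
    show "u \<in> {u. {v, u} \<in> E} \<longleftrightarrow> v \<in> {w. {u, w} \<in> E}" for u v
      by (simp add: insert_commute)
    show "v \<notin> {u. {v, u} \<in> E}" for v using EV(3)[of v v] by blast
  next
    fix A B assume card: "card A = 3" "card B = 3" and "\<And>a. a \<in> A \<Longrightarrow> B \<subseteq> {u. {a, u} \<in> E}"
    then have edges: "{a, b} \<in> E" if "a \<in> A" "b \<in> B" for a b using that by blast
    \<comment> \<open>Nonemptiness puts every vertex of \<open>A\<close> and \<open>B\<close> on an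
      edge, hence in \<open>V\<close>; the neighbourhoods alone do not mention
      \<open>V\<close>.\<close>
    have "A \<noteq> {}" "B \<noteq> {}" using card by auto
    then have "A \<subseteq> V" "B \<subseteq> V" "A \<inter> B = {}" using edges EV by blast+
    then show False using planar_no_K33[OF planar _ _ _ card edges] by blast
  next
    fix x y A B
    assume "x \<in> {u. {y, u} \<in> E}" "A \<subseteq> {u. {x, u} \<in> E} - {y}" "B \<subseteq> {u. {y, u} \<in> E} - {x}"
      and AB: "A \<inter> B = {}" "card A = 2" "card B = 5"
    then have yx: "{x, y} \<in> E" and xA: "\<And>a. a \<in> A \<Longrightarrow> {x, a} \<in> E \<and> a \<noteq> y"
      and yB: "\<And>b. b \<in> B \<Longrightarrow> {y, b} \<in> E \<and> b \<noteq> x" by (auto simp: insert_commute)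
    have "contains_copy V E (double_star_V (card A) (card B)) (double_star_E (card A) (card B))"
    proof (rule contains_double_star[of A B x y])
      show "finite A" "finite B" using AB by (auto intro: card_ge_0_finite)
      show "insert x (insert y (A \<union> B)) \<subseteq> V" "x \<noteq> y" "x \<notin> A \<union> B" "y \<notin> A \<union> B"
        using yx xA yB EV by blast+
    qed (use yx xA yB AB in auto)
    then show False using free AB by simp
  qed
  show ?thesis
    using degree_sum_bound[OF V] sum_degrees[OF simple] by (simp add: deg_def)
qed

theorem theorem1p1:
  fixes n :: nat
  assumes "n \<ge> 1"
  shows "real (ex_P n (double_star_V 2 5) (double_star_E 2 5)) \<le> 20 / 7 * real n"
proof -
  let ?P = "\<lambda>E. simple_graph {..<n} E \<and> planar {..<n} E \<and>
    \<not> contains_copy {..<n} E (double_star_V 2 5) (double_star_E 2 5)"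
  have "{card E | E. ?P E} \<subseteq> card ` Pow (Pow {..<n})"
    by (auto simp: simple_graph_def)
  then have "finite {card E | E. ?P E}"
    by (rule finite_subset) simp
  \<comment> \<open>The edgeless graph is admissible, so \<open>Max\<close> ranges over a nonempty
    finite set and is attained.\<close>
  moreover have "?P {}"
    by (auto simp: simple_graph_def planar_def contains_copy_def double_star_E_def
        intro!: exI[of _ of_nat] inj_onI)
  then have "{card E | E. ?P E} \<noteq> {}" by blast
  ultimately have "ex_P n (double_star_V 2 5) (double_star_E 2 5) \<in> {card E | E. ?P E}"
    unfolding ex_P_def by (rule Max_in)
  then obtain E where "ex_P n (double_star_V 2 5) (double_star_E 2 5) = card E" "?P E"
    by blast
  then have "7 * ex_P n (double_star_V 2 5) (double_star_E 2 5) \<le> 20 * n"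
    using planar_S25_free_edges[of "{..<n}" E] by simp
  then have "7 * real (ex_P n (double_star_V 2 5) (double_star_E 2 5)) \<le> 20 * real n"
    by linarith
  then show ?thesis by simp
qed

end
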